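(* Let $\mathbb{K}$ be a field of characteristic $0$. Let $(b|g;f_1,f_2)$ and $(c|d;h_1,h_2)$ be double almost-Riordan arrays in which $b,c$ are also even, $b=\sum_{k\ge0}b_{2k}t^{2k}$, $c=\sum_{k\ge0}c_{2k}t^{2k}$. Then the matrix product satisfies $$(b|g;f_1,f_2)(c|d;h_1,h_2)=\Big(c_0b+\frac{tg}{f_2}\big(c(\sqrt{f_1f_2})-c_0\big)\ \Big|\ g\,d(\sqrt{f_1f_2});\ \sqrt{\tfrac{f_1}{f_2}}\,h_1(\sqrt{f_1f_2}),\ \sqrt{\tfrac{f_2}{f_1}}\,h_2(\sqrt{f_1f_2})\Big).$$ Moreover, assuming there is an odd series $\sqrt{f_1f_2}\in\mathbb{K}[[t]]$ of order $1$ whose square is $f_1f_2$, and letting $\overline{f_{12}}$ be its compositional inverse ($\overline{f_{12}}(\sqrt{f_1f_2})=\sqrt{f_1f_2}(\overline{f_{12}})=t$), one has $$(b|g;f_1,f_2)^{-1}=\Big(\frac1{b_0}+\frac{f_2(\overline{f_{12}})}{b_0\,\overline{f_{12}}\,g(\overline{f_{12}})}\big(b_0-b(\overline{f_{12}})\big)\ \Big|\ \frac1{g(\overline{f_{12}})};\ \overline{f_{12}}\,\frac{t}{f_1(\overline{f_{12}})},\ \overline{f_{12}}\,\frac{t}{f_2(\overline{f_{12}})}\Big).$$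
   Context: For $b,g\in\mathbb{K}[[t]]$ with nonzero constant terms, $g$ even, and $f_1,f_2$ odd of order $1$ (nonzero coefficient of $t$), the double almost-Riordan array $(b|g;f_1,f_2)$ is the infinite lower triangular matrix whose $k$-th column has generating function $b$ for $k=0$, $tg(f_1f_2)^{\ell}$ for $k=2\ell+1$, and $tgf_1(f_1f_2)^{\ell}$ for $k=2\ell+2$. The same applies to $(c|d;h_1,h_2)$ ($d$ even, $h_1,h_2$ odd of order 1). Conventions: for an even series $e=\sum e_{2k}t^{2k}$, $e(\sqrt{f_1f_2}):=\sum_k e_{2k}(f_1f_2)^k$; for an odd series $h=\sum h_{2k+1}t^{2k+1}$, $\sqrt{f_1/f_2}\,h(\sqrt{f_1f_2}):=f_1\sum_k h_{2k+1}(f_1f_2)^k$ and $\sqrt{f_2/f_1}\,h(\sqrt{f_1f_2}):=f_2\sum_kh_{2k+1}(f_1f_2)^k$; and $\frac{tg}{f_2}(c(\sqrt{f_1f_2})-c_0)=tgf_1\sum_{k\ge1}c_{2k}(f_1f_2)^{k-1}$. *)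

theory Defs
  imports
    "HOL-Computational_Algebra.Formal_Power_Series"
    "HOL-Library.Groups_Big_Fun"
begin

unbundle fps_syntax

definition fps_even :: "'a::zero fps \<Rightarrow> bool" where
  "fps_even e \<longleftrightarrow> (\<forall>n. odd n \<longrightarrow> e $ n = 0)"

definition fps_odd :: "'a::zero fps \<Rightarrow> bool" where
  "fps_odd h \<longleftrightarrow> (\<forall>n. even n \<longrightarrow> h $ n = 0)"

definition double_almost_riordan ::
  "'a::field fps \<Rightarrow> 'a fps \<Rightarrow> 'a fps \<Rightarrow> 'a fps \<Rightarrow> bool" where
  "double_almost_riordan b g f1 f2 \<longleftrightarrow>
     b $ 0 \<noteq> 0 \<and> g $ 0 \<noteq> 0 \<and> fps_even g \<and>
     fps_odd f1 \<and> f1 $ 1 \<noteq> 0 \<and> fps_odd f2 \<and> f2 $ 1 \<noteq> 0"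

definition dar_column ::
  "'a::field fps \<Rightarrow> 'a fps \<Rightarrow> 'a fps \<Rightarrow> 'a fps \<Rightarrow> nat \<Rightarrow> 'a fps" where
  "dar_column b g f1 f2 k =
     (if k = 0 then b
      else if odd k then fps_X * g * (f1 * f2) ^ ((k - 1) div 2)
      else fps_X * g * f1 * (f1 * f2) ^ ((k - 2) div 2))"

text \<open>Infinite matrices are functions of the row index and the column index.\<close>

definition dar_array ::
  "'a::field fps \<Rightarrow> 'a fps \<Rightarrow> 'a fps \<Rightarrow> 'a fps \<Rightarrow> nat \<Rightarrow> nat \<Rightarrow> 'a" where
  "dar_array b g f1 f2 n k = dar_column b g f1 f2 k $ n"

text \<open>
  \<^const>\<open>Sum_any\<close> sums over the support of its argument. The support is finite here
  whenever \<open>A\<close> is lower triangular.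
\<close>

definition imat_mult ::
  "(nat \<Rightarrow> nat \<Rightarrow> 'a::field) \<Rightarrow> (nat \<Rightarrow> nat \<Rightarrow> 'a) \<Rightarrow> nat \<Rightarrow> nat \<Rightarrow> 'a" where
  "imat_mult A B n k = Sum_any (\<lambda>j. A n j * B j k)"

definition imat_one :: "nat \<Rightarrow> nat \<Rightarrow> 'a::field" where
  "imat_one n k = (if n = k then 1 else 0)"

definition imat_is_inverse ::
  "(nat \<Rightarrow> nat \<Rightarrow> 'a::field) \<Rightarrow> (nat \<Rightarrow> nat \<Rightarrow> 'a) \<Rightarrow> bool" where
  "imat_is_inverse A B \<longleftrightarrow> imat_mult A B = imat_one \<and> imat_mult B A = imat_one"

text \<open>
  \<open>even_at_sqrt e p\<close> is \<open>e(\<surd>p) = \<Sum>k. e\<^bsub>2k\<^esub> p\<^sup>k\<close> for even \<open>e\<close>, and \<open>odd_at_sqrt_ratio f h p\<close> is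
  \<open>f \<cdot> \<Sum>k. h\<^bsub>2k+1\<^esub> p\<^sup>k\<close> for odd \<open>h\<close>. With \<open>p = f1 f2\<close>, the latter is
  \<open>\<surd>(f1/f2) h(\<surd>(f1 f2))\<close> for \<open>f = f1\<close> and \<open>\<surd>(f2/f1) h(\<surd>(f1 f2))\<close> for \<open>f = f2\<close>.
  Both are meant for \<open>p\<close> with zero constant term, as required by \<^const>\<open>fps_compose\<close>.
\<close>

definition even_at_sqrt :: "'a::field fps \<Rightarrow> 'a fps \<Rightarrow> 'a fps" where
  "even_at_sqrt e p = Abs_fps (\<lambda>k. e $ (2 * k)) oo p"

definition odd_at_sqrt_ratio :: "'a::field fps \<Rightarrow> 'a fps \<Rightarrow> 'a fps \<Rightarrow> 'a fps" where
  "odd_at_sqrt_ratio f h p = f * (Abs_fps (\<lambda>k. h $ (2 * k + 1)) oo p)"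

text \<open>
  The quotient \<open>t g / f2\<close> of formal power series is exact, and so
  \<open>(t g / f2) (c(\<surd>(f1 f2)) - c\<^sub>0)\<close> is the expected series.
\<close>

lemma even_at_sqrt_quotient:
  fixes g f1 f2 c :: "'a::field fps"
  assumes "f1 $ 0 = 0" "f2 $ 0 = 0" "f2 $ 1 \<noteq> 0"
  shows "fps_X * g / f2 * (even_at_sqrt c (f1 * f2) - fps_const (c $ 0)) =
         fps_X * g * f1 * (Abs_fps (\<lambda>k. c $ (2 * (k + 1))) oo (f1 * f2))"
proof -
  let ?p = "f1 * f2" and ?q = "Abs_fps (\<lambda>k. c $ (2 * (k + 1)))"
  have p0: "?p $ 0 = 0" using assms by simp
  have "Abs_fps (\<lambda>k. c $ (2 * k)) = fps_const (c $ 0) + fps_X * ?q"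
    by (rule fps_ext) (auto simp: fps_X_mult_nth gr0_conv_Suc)
  then have ev: "even_at_sqrt c ?p - fps_const (c $ 0) = f2 * (f1 * (?q oo ?p))"
    by (simp add: even_at_sqrt_def fps_compose_add_distrib fps_compose_mult_distrib[OF p0]
        fps_X_fps_compose_startby0[OF p0] mult_ac)
  have f2: "f2 \<noteq> 0" "subdegree f2 = 1"
    using assms by (auto intro!: subdegreeI)
  have "f2 dvd fps_X * g"
  proof (cases "g = 0")
    case False
    with f2 show ?thesis by (subst fps_dvd_iff) auto
  qed simp
  then have "fps_X * g / f2 * f2 = fps_X * g" by simp
  then show ?thesis unfolding ev by (simp only: mult.assoc[symmetric])
qed

end

theory Submission
  imports Defs
begin

text \<open>
  Multiplying the array \<open>(b|g; f1, f2)\<close> with a column \<open>u = u\<^sub>0 + t O(t\<^sup>2) + t\<^sup>2 E(t\<^sup>2)\<close> gives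
  \<open>u\<^sub>0 b + t g O(f1 f2) + t g f1 E(f1 f2)\<close>. The columns of \<open>(c|d; h1, h2)\<close> with \<open>c\<close> even have
  definite parity, so only one of \<open>O\<close>, \<open>E\<close> survives, and substitution of \<open>f1 f2\<close> for \<open>t\<^sup>2\<close> is
  multiplicative. When \<open>s\<^sup>2 = f1 f2\<close>, this substitution is composition with \<open>s\<close>; for the inverse
  array \<open>h1 h2 = r\<^sup>2\<close> with \<open>r\<close> the compositional inverse of \<open>s\<close>, so the product formula shows that
  both products equal \<open>(1|1; t, t)\<close>, the identity matrix.
\<close>

section \<open>Parity as an equation under the substitution of -t\<close>

text \<open>Coefficient n of e(-t) is (-1)^n e_n, and in characteristic 0 only 0 equals its own
  negative. Closure properties of parity thereby become rewriting with the laws of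
  composition.\<close>

lemma fps_even_iff_compose_uminus_X:
  fixes e :: "'a::field_char_0 fps"
  shows "fps_even e \<longleftrightarrow> e oo - fps_X = e"
  by (auto simp: fps_even_def fps_compose_uminus' fps_eq_iff minus_one_power_iff)

lemma fps_odd_iff_compose_uminus_X:
  fixes h :: "'a::field_char_0 fps"
  shows "fps_odd h \<longleftrightarrow> h oo - fps_X = - h"
  by (auto simp: fps_odd_def fps_compose_uminus' fps_eq_iff minus_one_power_iff)

section \<open>Even and odd series as series in t^2\<close>

lemma fps_compose_X_square_nth:
  fixes F :: "'a::field fps"
  shows "(F oo fps_X\<^sup>2) $ n = (if even n then F $ (n div 2) else 0)"
proof -
  have "(F oo fps_X\<^sup>2) $ n = (\<Sum>i=0..n. if n = 2 * i then F $ i else 0)"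
    unfolding fps_compose_nth
    by (intro sum.cong) (simp_all flip: power_mult)
  also have "\<dots> = (\<Sum>i=0..n. if i = n div 2 then (if even n then F $ i else 0) else 0)"
    by (intro sum.cong) auto
  also have "\<dots> = (if even n then F $ (n div 2) else 0)"
    by simp
  finally show ?thesis .
qed

lemma fps_even_obtain:
  fixes e :: "'a::field fps"
  assumes "fps_even e"
  obtains F where "e = F oo fps_X\<^sup>2"
proof
  show "e = Abs_fps (\<lambda>k. e $ (2 * k)) oo fps_X\<^sup>2"
    using assms by (auto simp: fps_eq_iff fps_compose_X_square_nth fps_even_def)
qed

lemma fps_odd_obtain:
  fixes h :: "'a::field fps"
  assumes "fps_odd h"
  obtains F where "h = fps_X * (F oo fps_X\<^sup>2)"
proof
  show "h = fps_X * (Abs_fps (\<lambda>k. h $ (2 * k + 1)) oo fps_X\<^sup>2)"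
    using assms by (auto simp: fps_eq_iff fps_compose_X_square_nth fps_odd_def)
qed

lemma even_at_sqrt_compose: "even_at_sqrt (F oo fps_X\<^sup>2) p = F oo p"
  by (simp add: even_at_sqrt_def fps_compose_X_square_nth fps_nth_inverse)

lemma odd_at_sqrt_ratio_compose:
  "odd_at_sqrt_ratio f (fps_X * (F oo fps_X\<^sup>2)) p = f * (F oo p)"
  by (simp add: odd_at_sqrt_ratio_def fps_compose_X_square_nth fps_nth_inverse)

text \<open>If e = F(t^2), both sides are F(s^2). A genuine square root s of p thus turns the formal
  evaluation into composition with s.\<close>

lemma even_at_sqrt_square:
  fixes e s :: "'a::field fps"
  assumes "fps_even e" "s $ 0 = 0"
  shows "even_at_sqrt e (s\<^sup>2) = e oo s"
proof -
  obtain F where "e = F oo fps_X\<^sup>2"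
    using fps_even_obtain[OF assms(1)] .
  then show ?thesis
    using assms(2)
    by (simp add: even_at_sqrt_compose fps_X_power_compose flip: fps_compose_assoc)
qed

text \<open>If h = t F(t^2), then h(s) = s F(s^2). Multiplying by s avoids the quotient
  h(s)/s.\<close>

lemma odd_at_sqrt_ratio_square:
  fixes f h s :: "'a::field fps"
  assumes "fps_odd h" "s $ 0 = 0"
  shows "s * odd_at_sqrt_ratio f h (s\<^sup>2) = f * (h oo s)"
proof -
  obtain F where "h = fps_X * (F oo fps_X\<^sup>2)"
    using fps_odd_obtain[OF assms(1)] .
  then show ?thesis
    using assms(2)
    by (simp add: odd_at_sqrt_ratio_compose fps_X_power_compose fps_compose_mult_distrib
        flip: fps_compose_assoc)
qed

section \<open>Preservation of parity\<close>

lemma fps_even_even_at_sqrt: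
  fixes e p :: "'a::field_char_0 fps"
  assumes "fps_even p" "p $ 0 = 0"
  shows "fps_even (even_at_sqrt e p)"
  using assms
  by (simp add: fps_even_iff_compose_uminus_X even_at_sqrt_def flip: fps_compose_assoc)

lemma fps_odd_odd_at_sqrt_ratio:
  fixes f h p :: "'a::field_char_0 fps"
  assumes "fps_odd f" "fps_even p" "p $ 0 = 0"
  shows "fps_odd (odd_at_sqrt_ratio f h p)"
  using assms
  by (simp add: fps_even_iff_compose_uminus_X fps_odd_iff_compose_uminus_X
      odd_at_sqrt_ratio_def fps_compose_mult_distrib flip: fps_compose_assoc)

lemma fps_even_mult:
  fixes d e :: "'a::field_char_0 fps"
  assumes "fps_even d" "fps_even e"
  shows "fps_even (d * e)"
  using assms by (simp add: fps_even_iff_compose_uminus_X fps_compose_mult_distrib)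

lemma fps_even_odd_mult_odd:
  fixes f h :: "'a::field_char_0 fps"
  assumes "fps_odd f" "fps_odd h"
  shows "fps_even (f * h)"
  using assms
  by (simp add: fps_even_iff_compose_uminus_X fps_odd_iff_compose_uminus_X
      fps_compose_mult_distrib)

lemma fps_odd_mult_even:
  fixes h e :: "'a::field_char_0 fps"
  assumes "fps_odd h" "fps_even e"
  shows "fps_odd (h * e)"
  using assms
  by (simp add: fps_even_iff_compose_uminus_X fps_odd_iff_compose_uminus_X
      fps_compose_mult_distrib)

lemma fps_even_compose_odd:
  fixes e r :: "'a::field_char_0 fps"
  assumes "fps_even e" "fps_odd r"
  shows "fps_even (e oo r)"
proof -
  have r0: "r $ 0 = 0"
    using assms(2) by (simp add: fps_odd_def)
  have "(e oo r) oo - fps_X = e oo (- fps_X oo r)"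
    using assms(2) r0
    by (simp add: fps_odd_iff_compose_uminus_X fps_compose_uminus flip: fps_compose_assoc)
  also have "\<dots> = e oo r"
    using assms(1) r0 by (simp add: fps_even_iff_compose_uminus_X fps_compose_assoc)
  finally show ?thesis
    by (simp add: fps_even_iff_compose_uminus_X)
qed

lemma fps_odd_compose_odd:
  fixes h r :: "'a::field_char_0 fps"
  assumes "fps_odd h" "fps_odd r"
  shows "fps_odd (h oo r)"
proof -
  have r0: "r $ 0 = 0"
    using assms(2) by (simp add: fps_odd_def)
  have "(h oo r) oo - fps_X = h oo (- fps_X oo r)"
    using assms(2) r0
    by (simp add: fps_odd_iff_compose_uminus_X fps_compose_uminus flip: fps_compose_assoc)
  also have "\<dots> = - (h oo r)"
    using assms(1) r0
    by (simp add: fps_odd_iff_compose_uminus_X fps_compose_assoc)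
      (simp add: fps_compose_uminus)
  finally show ?thesis
    by (simp add: fps_odd_iff_compose_uminus_X)
qed

text \<open>Substituting -t in \<open>q * f = h\<close> changes the sign of \<open>f\<close> and
  \<open>h\<close>, so q(-t) f = q f, and \<open>f\<close> cancels.\<close>

lemma fps_even_quotient_odd:
  fixes q f h :: "'a::field_char_0 fps"
  assumes "q * f = h" "fps_odd f" "fps_odd h" "f \<noteq> 0"
  shows "fps_even q"
proof -
  have "(q oo - fps_X) * (f oo - fps_X) = h oo - fps_X"
    unfolding assms(1)[symmetric] by (simp add: fps_compose_mult_distrib)
  then have "(q oo - fps_X) * f = q * f"
    using assms by (simp add: fps_odd_iff_compose_uminus_X)
  with \<open>f \<noteq> 0\<close> show ?thesis
    by (simp add: fps_even_iff_compose_uminus_X)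
qed

text \<open>With r the inverse of s, oddness of s gives s(-r(t)) = -s(r(t)) = -t; applying r to both
  sides gives -r(t) = r(-t).\<close>

lemma fps_odd_fps_inv:
  fixes s :: "'a::field_char_0 fps"
  assumes "fps_odd s" "s $ 1 \<noteq> 0"
  shows "fps_odd (fps_inv s)"
proof -
  let ?r = "fps_inv s"
  have s0: "s $ 0 = 0" and r0: "?r $ 0 = 0"
    using assms by (auto simp: fps_odd_def fps_inv_def)
  have "- fps_X = - (s oo ?r)"
    using fps_inv_right[OF s0 assms(2)] by simp
  also have "\<dots> = (s oo - fps_X) oo ?r"
    using assms(1) by (simp add: fps_odd_iff_compose_uminus_X fps_compose_uminus)
  also have "\<dots> = s oo - ?r"
    using r0 by (simp add: fps_compose_uminus flip: fps_compose_assoc)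
  finally have "?r oo - fps_X = (?r oo s) oo - ?r"
    using s0 r0 by (simp add: fps_compose_assoc)
  also have "\<dots> = - ?r"
    using fps_inv[OF s0 assms(2)] r0 by simp
  finally show ?thesis
    by (simp add: fps_odd_iff_compose_uminus_X)
qed

section \<open>The columns of an array and its action on a coefficient vector\<close>

lemma fps_mult_compose_nth:
  fixes F u p :: "'a::field fps"
  assumes "p $ 0 = 0"
  shows "(F * (u oo p)) $ n = (\<Sum>l\<le>n. u $ l * (F * p ^ l) $ n)"
proof -
  \<comment> \<open>Since p^l has order at least l, the range of l can be enlarged from n - i to n.
    It then no longer depends on i, and the two sums can be exchanged.\<close>
  have "(u oo p) $ (n - i) = (\<Sum>l\<le>n. u $ l * (p ^ l) $ (n - i))" for i
    unfolding fps_compose_nth atLeast0AtMost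
    using startsby_zero_power_prefix[OF assms]
    by (intro sum.mono_neutral_left) auto
  then have "(F * (u oo p)) $ n =
      (\<Sum>i=0..n. \<Sum>l\<le>n. u $ l * (F $ i * (p ^ l) $ (n - i)))"
    by (simp add: fps_mult_nth sum_distrib_left mult_ac)
  also have "\<dots> = (\<Sum>l\<le>n. \<Sum>i=0..n. u $ l * (F $ i * (p ^ l) $ (n - i)))"
    by (rule sum.swap)
  finally show ?thesis
    by (simp add: fps_mult_nth sum_distrib_left)
qed

lemma nat_zero_odd_even_cases:
  fixes k :: nat
  obtains "k = 0" | l where "k = 2 * l + 1" | l where "k = 2 * l + 2"
  by (metis Suc_eq_plus1 add_2_eq_Suc' evenE mult_Suc_right not0_implies_Suc oddE)

text \<open>Each of \<open>f1\<close> and \<open>f2\<close> contributes a factor t, so column k is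
  divisible by t^k. This triangularity makes the sums in the matrix product finite.\<close>

lemma dar_column_nth_eq_0:
  assumes "f1 $ 0 = 0" "f2 $ 0 = 0" "n < k"
  shows "dar_column b g f1 f2 k $ n = 0"
proof -
  obtain a1 a2 where f: "f1 = fps_X * a1" "f2 = fps_X * a2"
  proof
    show "f1 = fps_X * fps_shift 1 f1" "f2 = fps_X * fps_shift 1 f2"
      using assms(1,2) by (auto simp: fps_eq_iff)
  qed
  have pow: "(f1 * f2) ^ l = fps_X ^ (2 * l) * (a1 * a2) ^ l" for l
    by (simp add: f power_mult_distrib power_mult power2_eq_square mult_ac)
  consider "k = 0" | l where "k = 2 * l + 1" | l where "k = 2 * l + 2"
    by (rule nat_zero_odd_even_cases)
  then obtain v where "dar_column b g f1 f2 k = fps_X ^ k * v"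
  proof cases
    case 1
    then show ?thesis using assms by simp
  next
    case (2 l)
    then have "dar_column b g f1 f2 k = fps_X ^ k * (g * (a1 * a2) ^ l)"
      by (simp add: dar_column_def pow mult_ac)
    then show ?thesis by (rule that)
  next
    case (3 l)
    then have "dar_column b g f1 f2 k = fps_X ^ k * (g * a1 * (a1 * a2) ^ l)"
      by (simp add: dar_column_def pow mult_ac) (simp add: f mult_ac)
    then show ?thesis by (rule that)
  qed
  with assms(3) show ?thesis
    by (simp add: fps_X_power_mult_nth)
qed

lemma sum_split_odd_even:
  fixes F :: "nat \<Rightarrow> 'a::comm_monoid_add"
  shows "(\<Sum>j\<le>2 * Suc n. F j) = F 0 + (\<Sum>l\<le>n. F (2 * l + 1)) + (\<Sum>l\<le>n. F (2 * l + 2))"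
  by (induction n) (simp_all add: numeral_2_eq_2 add_ac)

text \<open>With p = f1 f2, the columns 2l+1 are t g p^l and the columns 2l+2 are t g f1 p^l, so the
  sum over each class is a composition with p.\<close>

lemma dar_array_apply:
  fixes b g f1 f2 u :: "'a::field fps"
  assumes "f1 $ 0 = 0" "f2 $ 0 = 0"
  shows "Sum_any (\<lambda>j. dar_array b g f1 f2 n j * u $ j) =
    (fps_const (u $ 0) * b
      + fps_X * g * (Abs_fps (\<lambda>l. u $ (2 * l + 1)) oo (f1 * f2))
      + fps_X * g * f1 * (Abs_fps (\<lambda>l. u $ (2 * l + 2)) oo (f1 * f2))) $ n"
proof -
  let ?F = "\<lambda>j. dar_array b g f1 f2 n j * u $ j"
  \<comment> \<open>Triangularity already gives the bound n. The larger bound 2n+2 splits into index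
    0 and two classes that both run over l \<le> n, the range in
    \<open>fps_mult_compose_nth\<close>.\<close>
  have "{j. ?F j \<noteq> 0} \<subseteq> {..2 * Suc n}"
  proof
    fix j assume "j \<in> {j. ?F j \<noteq> 0}"
    then have "\<not> n < j"
      using dar_column_nth_eq_0[OF assms, of n j b g] by (auto simp: dar_array_def)
    then show "j \<in> {..2 * Suc n}" by simp
  qed
  then have "Sum_any ?F = (\<Sum>j\<le>2 * Suc n. ?F j)"
    by (intro Sum_any.expand_superset) auto
  also have "\<dots> = ?F 0 + (\<Sum>l\<le>n. ?F (2 * l + 1)) + (\<Sum>l\<le>n. ?F (2 * l + 2))"
    by (rule sum_split_odd_even)
  finally show ?thesis
    using assms
    by (simp only: fps_add_nth fps_mult_compose_nth fps_mult_nth_0 mult_zero_left)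
      (simp add: dar_array_def dar_column_def mult_ac)
qed

section \<open>The product formula\<close>

lemma dar_array_mult:
  fixes b g f1 f2 c d h1 h2 :: "'a::field fps"
  assumes "f1 $ 0 = 0" "f2 $ 0 = 0" "f2 $ 1 \<noteq> 0"
    and "fps_even c" "fps_even d" "fps_odd h1" "fps_odd h2"
  shows "imat_mult (dar_array b g f1 f2) (dar_array c d h1 h2) =
    dar_array (fps_const (c $ 0) * b
        + fps_X * g / f2 * (even_at_sqrt c (f1 * f2) - fps_const (c $ 0)))
      (g * even_at_sqrt d (f1 * f2))
      (odd_at_sqrt_ratio f1 h1 (f1 * f2)) (odd_at_sqrt_ratio f2 h2 (f1 * f2))"
proof (intro ext)
  fix n k
  let ?p = "f1 * f2"
  have p0: "?p $ 0 = 0" using assms by simp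
  obtain D H1 H2 where eqs: "d = D oo fps_X\<^sup>2" "h1 = fps_X * (H1 oo fps_X\<^sup>2)"
      "h2 = fps_X * (H2 oo fps_X\<^sup>2)"
    using fps_even_obtain fps_odd_obtain assms(5-7) by metis
  \<comment> \<open>As h1 h2 = t^2 H1(t^2) H2(t^2), the series \<open>G l\<close> is d (h1 h2)^l
    written in the variable t^2; the factor \<open>fps_X\<close> stands for that t^2.\<close>
  define G where "G l = D * (fps_X * H1 * H2) ^ l" for l
  \<comment> \<open>The base of the power is (f1 H1(p)) (f2 H2(p)), the product of the last two
    entries of the resulting array.\<close>
  have Gp: "G l oo ?p = (D oo ?p) * (?p * (H1 oo ?p) * (H2 oo ?p)) ^ l" for l
    using p0 by (simp add: G_def fps_compose_mult_distrib flip: fps_compose_power)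
  have GX: "G l oo fps_X\<^sup>2 = d * (h1 * h2) ^ l" for l
    by (simp add: G_def eqs fps_compose_mult_distrib power2_eq_square mult_ac
        flip: fps_compose_power)
  have mult_col: "imat_mult (dar_array b g f1 f2) (dar_array c d h1 h2) n k =
      (fps_const (dar_column c d h1 h2 k $ 0) * b
        + fps_X * g * (Abs_fps (\<lambda>l. dar_column c d h1 h2 k $ (2 * l + 1)) oo ?p)
        + fps_X * g * f1 * (Abs_fps (\<lambda>l. dar_column c d h1 h2 k $ (2 * l + 2)) oo ?p)) $ n"
    unfolding dar_array_apply[OF assms(1,2), symmetric]
    by (simp add: imat_mult_def dar_array_def)
  consider "k = 0" | l where "k = 2 * l + 1" | l where "k = 2 * l + 2"
    by (rule nat_zero_odd_even_cases)
  then show "imat_mult (dar_array b g f1 f2) (dar_array c d h1 h2) n k =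
    dar_array (fps_const (c $ 0) * b
        + fps_X * g / f2 * (even_at_sqrt c ?p - fps_const (c $ 0)))
      (g * even_at_sqrt d ?p)
      (odd_at_sqrt_ratio f1 h1 ?p) (odd_at_sqrt_ratio f2 h2 ?p) n k"
  proof cases
    case 1
    \<comment> \<open>Column 0 is c itself. Its odd part vanishes, and its even part beyond c_0
      gives the term with t g / f2.\<close>
    have "Abs_fps (\<lambda>l. c $ (2 * l + 1)) = 0"
      using assms(4) by (simp add: fps_eq_iff fps_even_def)
    with 1 show ?thesis
      unfolding mult_col even_at_sqrt_quotient[OF assms(1-3)]
      by (simp add: dar_array_def dar_column_def)
  next
    case (2 l)
    have col: "dar_column c d h1 h2 k = fps_X * (G l oo fps_X\<^sup>2)"
      using 2 by (simp add: dar_column_def GX mult_ac)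
    have odds: "Abs_fps (\<lambda>m. dar_column c d h1 h2 k $ (2 * m + 1)) = G l"
      by (simp add: fps_eq_iff col fps_compose_X_square_nth)
    have evens: "Abs_fps (\<lambda>m. dar_column c d h1 h2 k $ (2 * m + 2)) = 0"
      by (simp add: fps_eq_iff col fps_compose_X_square_nth)
    have const: "dar_column c d h1 h2 k $ 0 = 0"
      by (simp add: col)
    show ?thesis
      unfolding mult_col odds evens const Gp using 2
      by (simp add: dar_array_def dar_column_def eqs even_at_sqrt_compose
          odd_at_sqrt_ratio_compose mult_ac)
  next
    case (3 l)
    \<comment> \<open>The additional factor h1 = t H1(t^2) makes this column even and divisible by
      t^2, so reading off the indices 2m+2 yields exactly \<open>H1 * G l\<close>.\<close>
    have col: "dar_column c d h1 h2 k = fps_X * (fps_X * (H1 * G l oo fps_X\<^sup>2))"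
      using 3 by (simp add: dar_column_def fps_compose_mult_distrib GX eqs(2) mult_ac)
    have odds: "Abs_fps (\<lambda>m. dar_column c d h1 h2 k $ (2 * m + 1)) = 0"
      by (simp add: fps_eq_iff col fps_compose_X_square_nth)
    have evens: "Abs_fps (\<lambda>m. dar_column c d h1 h2 k $ (2 * m + 2)) = H1 * G l"
      by (simp add: fps_eq_iff col fps_compose_X_square_nth)
    have const: "dar_column c d h1 h2 k $ 0 = 0"
      by (simp add: col)
    show ?thesis
      unfolding mult_col odds evens const fps_compose_mult_distrib[OF p0] Gp using 3
      by (simp add: dar_array_def dar_column_def eqs even_at_sqrt_compose
          odd_at_sqrt_ratio_compose mult_ac)
  qed
qed

section \<open>The identity array and quotients by series of order 1\<close>

lemma dar_array_one: "dar_array 1 1 fps_X fps_X = imat_one"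
proof (intro ext)
  fix n k :: nat
  consider "k = 0" | l where "k = 2 * l + 1" | l where "k = 2 * l + 2"
    by (rule nat_zero_odd_even_cases)
  then have "dar_column 1 1 fps_X fps_X k = (fps_X ^ k :: 'a fps)"
    by cases (simp_all add: dar_column_def power2_eq_square power_mult mult.assoc)
  then show "dar_array 1 1 fps_X fps_X n k = (imat_one n k :: 'a)"
    by (simp add: dar_array_def imat_one_def)
qed

text \<open>A series of order 1 divides every series without constant term; comparing coefficients
  of t gives h_1 = (h/f)_0 f_1.\<close>

lemma fps_quotient_order_1:
  fixes f h :: "'a::field fps"
  assumes "f $ 0 = 0" "f $ 1 \<noteq> 0" "h $ 0 = 0"
  shows "h / f * f = h" and "h $ 1 \<noteq> 0 \<Longrightarrow> (h / f) $ 0 \<noteq> 0"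
proof -
  have f: "f \<noteq> 0" "subdegree f = 1"
    using assms by (auto intro!: subdegreeI)
  have "f dvd h"
  proof (cases "h = 0")
    case False
    then have "subdegree h \<noteq> 0"
      using assms(3) by (simp add: subdegree_eq_0_iff)
    with f False show ?thesis by (simp add: fps_dvd_iff)
  qed simp
  then show quot: "h / f * f = h" by simp
  have "h $ 1 = (h / f) $ 0 * f $ 1"
    by (subst quot[symmetric]) (simp add: fps_mult_nth_1 assms(1))
  then show "h $ 1 \<noteq> 0 \<Longrightarrow> (h / f) $ 0 \<noteq> 0"
    by auto
qed

lemma fps_compose_nth_1:
  fixes f r :: "'a::field fps"
  shows "(f oo r) $ 1 = f $ 1 * r $ 1"
  by (simp add: fps_compose_nth)

section \<open>Product and inverse of double almost-Riordan arrays\<close>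

theorem theorem2p3:
  fixes b g f1 f2 c d h1 h2 :: "'a::field_char_0 fps"
  assumes "double_almost_riordan b g f1 f2" and "fps_even b"
    and "double_almost_riordan c d h1 h2" and "fps_even c"
  shows
    "(let b' = fps_const (c $ 0) * b
                 + fps_X * g / f2 * (even_at_sqrt c (f1 * f2) - fps_const (c $ 0));
          g' = g * even_at_sqrt d (f1 * f2);
          f1' = odd_at_sqrt_ratio f1 h1 (f1 * f2);
          f2' = odd_at_sqrt_ratio f2 h2 (f1 * f2)
      in double_almost_riordan b' g' f1' f2' \<and>
         imat_mult (dar_array b g f1 f2) (dar_array c d h1 h2) = dar_array b' g' f1' f2')
     \<and>
     (\<forall>s. fps_odd s \<and> s $ 1 \<noteq> 0 \<and> s\<^sup>2 = f1 * f2 \<longrightarrow>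
        (let r = fps_inv s;
             b' = fps_const (1 / b $ 0)
                    + (f2 oo r) / (fps_const (b $ 0) * r * (g oo r))
                      * (fps_const (b $ 0) - (b oo r));
             g' = 1 / (g oo r);
             f1' = r * (fps_X / (f1 oo r));
             f2' = r * (fps_X / (f2 oo r))
         in r oo s = fps_X \<and> s oo r = fps_X \<and>
            double_almost_riordan b' g' f1' f2' \<and>
            imat_is_inverse (dar_array b g f1 f2) (dar_array b' g' f1' f2')))"
proof -
  have b0: "b $ 0 \<noteq> 0" and g0: "g $ 0 \<noteq> 0" and g_even: "fps_even g"
    and f1: "fps_odd f1" "f1 $ 1 \<noteq> 0" "f1 $ 0 = 0"
    and f2: "fps_odd f2" "f2 $ 1 \<noteq> 0" "f2 $ 0 = 0"
    using assms(1) by (auto simp: double_almost_riordan_def fps_odd_def)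
  have c0: "c $ 0 \<noteq> 0" and d0: "d $ 0 \<noteq> 0" and d_even: "fps_even d"
    and h1: "fps_odd h1" "h1 $ 1 \<noteq> 0"
    and h2: "fps_odd h2" "h2 $ 1 \<noteq> 0"
    using assms(3) by (auto simp: double_almost_riordan_def)
  let ?p = "f1 * f2"
  have p: "fps_even ?p" "?p $ 0 = 0"
    using f1 f2 by (auto intro: fps_even_odd_mult_odd)

  \<comment> \<open>The series \<open>even_at_sqrt c ?p\<close> has constant term c_0, so the first
    entry has constant term c_0 b_0. The coefficients of t in the last two entries are products of
    those of f1, h1 and of f2, h2.\<close>
  have product: "double_almost_riordan
      (fps_const (c $ 0) * b + fps_X * g / f2 * (even_at_sqrt c ?p - fps_const (c $ 0)))
      (g * even_at_sqrt d ?p) (odd_at_sqrt_ratio f1 h1 ?p) (odd_at_sqrt_ratio f2 h2 ?p)"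
    unfolding double_almost_riordan_def
  proof (intro conjI)
    show "fps_even (g * even_at_sqrt d ?p)"
      by (intro fps_even_mult g_even fps_even_even_at_sqrt p)
    show "fps_odd (odd_at_sqrt_ratio f1 h1 ?p)" "fps_odd (odd_at_sqrt_ratio f2 h2 ?p)"
      by (intro fps_odd_odd_at_sqrt_ratio f1 f2 p)+
    show "odd_at_sqrt_ratio f1 h1 ?p $ 1 \<noteq> 0" "odd_at_sqrt_ratio f2 h2 ?p $ 1 \<noteq> 0"
      using f1 f2 h1 h2 by (simp_all add: odd_at_sqrt_ratio_def fps_mult_nth_1)
  qed (use b0 c0 g0 d0 in \<open>simp_all add: even_at_sqrt_def\<close>)

  have inverse: "fps_inv s oo s = fps_X \<and> s oo fps_inv s = fps_X \<and>
      double_almost_riordan b' g' f1' f2' \<and>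
      imat_is_inverse (dar_array b g f1 f2) (dar_array b' g' f1' f2')"
    if s: "fps_odd s" "s $ 1 \<noteq> 0" "s\<^sup>2 = ?p"
      and defs: "r = fps_inv s"
        "b' = fps_const (1 / b $ 0)
           + (f2 oo r) / (fps_const (b $ 0) * r * (g oo r)) * (fps_const (b $ 0) - (b oo r))"
        "g' = 1 / (g oo r)" "f1' = r * (fps_X / (f1 oo r))" "f2' = r * (fps_X / (f2 oo r))"
    for s r b' g' f1' f2'
  proof -
    have s0: "s $ 0 = 0"
      using s by (simp add: fps_odd_def)
    have rs: "r oo s = fps_X" and sr: "s oo r = fps_X"
      unfolding defs(1) by (rule fps_inv fps_inv_right; fact)+
    have r_odd: "fps_odd r"
      unfolding defs(1) by (rule fps_odd_fps_inv; fact)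
    have r0: "r $ 0 = 0"
      using r_odd by (simp add: fps_odd_def)
    have "(s oo r) $ 1 = 1"
      by (simp add: sr)
    then have r1: "r $ 1 \<noteq> 0"
      by (auto simp: fps_compose_nth_1 simp del: One_nat_def)
    have nz: "r \<noteq> 0" "s \<noteq> 0" "f1 \<noteq> 0" "f2 \<noteq> 0" "g \<noteq> 0" "fps_const (b $ 0) \<noteq> 0"
      using r1 s f1 f2 g0 b0 by auto
    have comp_s: "(u oo r) oo s = u" for u :: "'a fps"
      using s0 r0 rs by (simp flip: fps_compose_assoc)

    \<comment> \<open>All three denominators have order 1 and the numerators have no constant term,
      so these quotients are exact and can be handled through their multiplicative
      equations.\<close>
    define q1 where "q1 = fps_X / (f1 oo r)"
    define q2 where "q2 = fps_X / (f2 oo r)"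
    define w where "w = (f2 oo r) / (fps_const (b $ 0) * r * (g oo r))"
    have f1r: "fps_odd (f1 oo r)" "(f1 oo r) $ 1 \<noteq> 0" "(f1 oo r) $ 0 = 0"
      and f2r: "fps_odd (f2 oo r)" "(f2 oo r) $ 1 \<noteq> 0" "(f2 oo r) $ 0 = 0"
      using f1 f2 r_odd r1 by (simp_all add: fps_odd_compose_odd fps_compose_nth_1 del: One_nat_def)
    have gr: "fps_even (g oo r)" "(g oo r) $ 0 \<noteq> 0"
      using g_even g0 r_odd by (simp_all add: fps_even_compose_odd)
    have nzr: "f1 oo r \<noteq> 0" "f2 oo r \<noteq> 0" "g oo r \<noteq> 0"
      using f1r f2r gr by (metis fps_zero_nth)+
    have q1: "q1 * (f1 oo r) = fps_X" "q1 $ 0 \<noteq> 0"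
      unfolding q1_def using fps_quotient_order_1[OF f1r(3,2), of fps_X] by simp_all
    have q2: "q2 * (f2 oo r) = fps_X" "q2 $ 0 \<noteq> 0"
      unfolding q2_def using fps_quotient_order_1[OF f2r(3,2), of fps_X] by simp_all
    have w: "w * (fps_const (b $ 0) * r * (g oo r)) = f2 oo r"
      unfolding w_def
      by (rule fps_quotient_order_1(1))
        (use r0 r1 gr b0 f2r in \<open>simp_all add: fps_mult_nth_1\<close>)
    have g': "g' * (g oo r) = 1"
      using gr by (simp add: defs(3) fps_divide_unit inverse_mult_eq_1)
    have X_odd: "fps_odd (fps_X :: 'a fps)"
      by (simp add: fps_odd_def)
    have q_even: "fps_even q1" "fps_even q2"
      using fps_even_quotient_odd[OF q1(1) f1r(1) X_odd] fps_even_quotient_odd[OF q2(1) f2r(1) X_odd]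
        nzr by simp_all
    have const_even: "fps_even (fps_const a)" for a :: 'a
      by (auto simp: fps_even_def)
    have "fps_odd (r * (fps_const (b $ 0) * (g oo r)))"
      by (intro fps_odd_mult_even fps_even_mult r_odd gr const_even)
    then have w_even: "fps_even w"
      using w nz nzr f2r(1) by (intro fps_even_quotient_odd[OF w]) (simp_all add: mult_ac)
    have b': "b' = fps_const (1 / b $ 0) + w * (fps_const (b $ 0) - (b oo r))"
      and f1': "f1' = r * q1" and f2': "f2' = r * q2"
      unfolding defs(2,4,5) q1_def q2_def w_def by (rule refl)+
    have b'0: "b' $ 0 = 1 / b $ 0"
      by (simp add: b')
    have br: "fps_even (b oo r)"
      using assms(2) r_odd by (rule fps_even_compose_odd)
    \<comment> \<open>The product formula requires an even first entry in the right factor, which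
      here is \<open>b'\<close> when the inverse stands on the right.\<close>
    have b'_even: "fps_even b'"
      using fps_even_mult[OF w_even, of "fps_const (b $ 0) - (b oo r)"] br
      by (auto simp: b' fps_even_def)
    have g'_even: "fps_even g'"
    proof -
      have "(g' oo - fps_X) * (g oo r) = 1"
        using arg_cong[OF g', of "\<lambda>u. u oo - fps_X"] gr(1)
        by (simp add: fps_compose_mult_distrib fps_even_iff_compose_uminus_X)
      then have "(g' oo - fps_X) * (g oo r) = g' * (g oo r)"
        by (simp only: g')
      with nzr show ?thesis
        by (simp add: fps_even_iff_compose_uminus_X)
    qed
    have g'0: "g' $ 0 \<noteq> 0"
      using arg_cong[OF g', of "\<lambda>u. u $ 0"] by auto
    have f1'_odd: "fps_odd f1'" and f2'_odd: "fps_odd f2'"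
      unfolding f1' f2' by (intro fps_odd_mult_even r_odd q_even)+
    have f'1: "f1' $ 1 \<noteq> 0" "f2' $ 1 \<noteq> 0"
      using r0 r1 q1 q2 by (simp_all add: f1' f2' fps_mult_nth_1)
    have f'0: "f1' $ 0 = 0" "f2' $ 0 = 0"
      using r0 by (simp_all add: f1' f2')
    have dar: "double_almost_riordan b' g' f1' f2'"
      unfolding double_almost_riordan_def
      using b0 b'0 g'0 g'_even f1'_odd f2'_odd f'1 by simp

    have left: "imat_mult (dar_array b g f1 f2) (dar_array b' g' f1' f2') = imat_one"
    proof -
      have b's: "b' oo s = fps_const (1 / b $ 0) + (w oo s) * (fps_const (b $ 0) - b)"
        using s0 by (simp add: b' fps_compose_add_distrib fps_compose_sub_distrib
            fps_compose_mult_distrib comp_s)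
      have ws: "(w oo s) * (fps_const (b $ 0) * fps_X * g) = f2"
        using arg_cong[OF w, of "\<lambda>u. u oo s"] s0
        by (simp add: fps_compose_mult_distrib comp_s rs)
      \<comment> \<open>By \<open>ws\<close>, b_0 w(s) is inverse to t g / f2. The first entry,
        multiplied by b_0, therefore collapses to b + (b_0 - b) = b_0.\<close>
      have "f2 * (fps_X * g / f2 * (w oo s) * fps_const (b $ 0)) =
          (fps_X * g / f2 * f2) * ((w oo s) * fps_const (b $ 0))"
        by (simp only: mult_ac)
      also have "\<dots> = fps_X * g * ((w oo s) * fps_const (b $ 0))"
        using fps_quotient_order_1(1)[OF f2(3,2), of "fps_X * g"] by simp
      also have "\<dots> = f2 * 1"
        using ws by (simp add: mult_ac)
      finally have ws': "fps_X * g / f2 * (w oo s) * fps_const (b $ 0) = 1"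
        using nz by (simp only: mult_cancel_left) simp
      have "fps_const (b $ 0) * (fps_const (b' $ 0) * b
          + fps_X * g / f2 * ((b' oo s) - fps_const (b' $ 0))) =
          b + fps_X * g / f2 * (w oo s) * fps_const (b $ 0) * (fps_const (b $ 0) - b)"
        using b0 by (simp add: b'0 b's algebra_simps)
      also have "\<dots> = fps_const (b $ 0) * 1"
        by (simp add: ws')
      finally have 1: "fps_const (b' $ 0) * b
          + fps_X * g / f2 * ((b' oo s) - fps_const (b' $ 0)) = 1"
        using nz by (simp only: mult_cancel_left) simp
      have 2: "g * (g' oo s) = 1"
        using arg_cong[OF g', of "\<lambda>u. u oo s"] s0
        by (simp add: fps_compose_mult_distrib comp_s mult_ac)
      have qs: "(q1 oo s) * f1 = s" "(q2 oo s) * f2 = s"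
        using arg_cong[OF q1(1), of "\<lambda>u. u oo s"] arg_cong[OF q2(1), of "\<lambda>u. u oo s"] s0
        by (simp_all add: fps_compose_mult_distrib comp_s)
      \<comment> \<open>Here f1'(s) = r(s) q1(s) = t q1(s), and q1(s) f1 = s; cancelling s leaves
        t.\<close>
      have "s * odd_at_sqrt_ratio f1 f1' (s\<^sup>2) = f1 * (f1' oo s)"
        by (rule odd_at_sqrt_ratio_square[OF f1'_odd s0])
      also have "\<dots> = s * fps_X"
        using qs(1) s0 by (simp add: f1' fps_compose_mult_distrib rs mult_ac)
      finally have 3: "odd_at_sqrt_ratio f1 f1' (s\<^sup>2) = fps_X"
        using nz by simp
      have "s * odd_at_sqrt_ratio f2 f2' (s\<^sup>2) = f2 * (f2' oo s)"
        by (rule odd_at_sqrt_ratio_square[OF f2'_odd s0])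
      also have "\<dots> = s * fps_X"
        using qs(2) s0 by (simp add: f2' fps_compose_mult_distrib rs mult_ac)
      finally have 4: "odd_at_sqrt_ratio f2 f2' (s\<^sup>2) = fps_X"
        using nz by simp
      show ?thesis
        unfolding dar_array_mult[OF f1(3) f2(3,2) b'_even g'_even f1'_odd f2'_odd]
          s(3)[symmetric] even_at_sqrt_square[OF b'_even s0] even_at_sqrt_square[OF g'_even s0]
          1 2 3 4 by (rule dar_array_one)
    qed

    have right: "imat_mult (dar_array b' g' f1' f2') (dar_array b g f1 f2) = imat_one"
    proof -
      \<comment> \<open>Since (f1 f2)(r) = s(r)^2 = t^2, the quotients satisfy q1 q2 = 1. Hence f1'
        f2' = r^2, and r serves as the square root for the reversed product.\<close>
      have "(f1 oo r) * (f2 oo r) = fps_X\<^sup>2"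
        using arg_cong[OF s(3), of "\<lambda>u. u oo r"] r0
        by (simp add: fps_compose_mult_distrib sr flip: fps_compose_power)
      then have "q1 * q2 * fps_X\<^sup>2 = (q1 * (f1 oo r)) * (q2 * (f2 oo r))"
        by (simp add: mult_ac)
      also have "\<dots> = 1 * fps_X\<^sup>2"
        by (simp add: q1 q2 power2_eq_square)
      finally have "q1 * q2 = 1"
        by (simp only: mult_cancel_right) simp
      then have p': "f1' * f2' = r\<^sup>2"
        by (simp add: f1' f2' power2_eq_square mult_ac)
      \<comment> \<open>Replacing t by q2 f2(r), and f2(r) by w times its denominator, produces the
        factor f2' = r q2, which cancels.\<close>
      have "f2' * (fps_X * g' / f2') = fps_X * g'"
        using fps_quotient_order_1(1)[OF f'0(2) f'1(2), of "fps_X * g'"] by (simp add: mult_ac)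
      also have "\<dots> = q2 * (w * (fps_const (b $ 0) * r * (g oo r))) * g'"
        by (simp add: w q2)
      also have "\<dots> = f2' * (w * fps_const (b $ 0)) * (g' * (g oo r))"
        by (simp only: f2' mult_ac)
      finally have "f2' * (fps_X * g' / f2') = f2' * (w * fps_const (b $ 0))"
        by (simp add: g')
      moreover have "f2' \<noteq> 0"
        using f'1 by auto
      ultimately have quot: "fps_X * g' / f2' = w * fps_const (b $ 0)"
        by (simp only: mult_cancel_left) simp
      \<comment> \<open>The term b_0 w (b_0 - b(r)) of b_0 b' cancels against the correction,
        leaving b_0 / b_0 = 1.\<close>
      have 1: "fps_const (b $ 0) * b' + fps_X * g' / f2' * ((b oo r) - fps_const (b $ 0)) = 1"
        unfolding quot using b0 by (simp add: b' algebra_simps)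
      have 2: "g' * (g oo r) = 1"
        by (rule g')
      have "r * odd_at_sqrt_ratio f1' f1 (r\<^sup>2) = f1' * (f1 oo r)"
        by (rule odd_at_sqrt_ratio_square[OF f1(1) r0])
      also have "\<dots> = r * fps_X"
        using q1 by (simp add: f1' mult_ac)
      finally have 3: "odd_at_sqrt_ratio f1' f1 (r\<^sup>2) = fps_X"
        using nz by simp
      have "r * odd_at_sqrt_ratio f2' f2 (r\<^sup>2) = f2' * (f2 oo r)"
        by (rule odd_at_sqrt_ratio_square[OF f2(1) r0])
      also have "\<dots> = r * fps_X"
        using q2 by (simp add: f2' mult_ac)
      finally have 4: "odd_at_sqrt_ratio f2' f2 (r\<^sup>2) = fps_X"
        using nz by simp
      show ?thesis
        unfolding dar_array_mult[OF f'0 f'1(2) assms(2) g_even f1(1) f2(1)] p'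
          even_at_sqrt_square[OF assms(2) r0] even_at_sqrt_square[OF g_even r0]
          1 2 3 4 by (rule dar_array_one)
    qed

    show ?thesis
      using rs sr dar left right by (simp add: imat_is_inverse_def defs(1))
  qed

  show ?thesis
    unfolding Let_def
    using product dar_array_mult[OF f1(3) f2(3,2) assms(4) d_even h1(1) h2(1)] inverse
    by blast
qed

end
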